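(* Let $U$ be a (complex) Banach space and let $G(\cdot\,;\cdot)$ be an analytic functional on $\mathbb{C}\times U$ (that is, an analytic map $G:\mathbb{C}\times U\to\mathbb{C}$). Assume that (i) $S$ is a convex subset of $U$; (ii) $z_0\in\mathbb{C}$ and $u_0\in S$ are such that $G(z_0;u_0)=0$; (iii) $\frac{\partial G(z_0;u_0)}{\partial u}(u_0)$ is an interior point (in $\mathbb{C}$) of the set of directional derivatives $\frac{\partial G(z_0;u_0)}{\partial u}[S]$. Then $z_0$ is a strongly $u_0$-local interior point of $\Sigma_G[S]$.
   Context: For $u\in U$, $\Sigma_G(u):=\{z\in\mathbb{C}: G(z;u)=0\}$, and for $S\subset U$, $\Sigma_G[S]:=\bigcup_{u\in S}\Sigma_G(u)$. The directional derivative of $G(z;\cdot)$ at $u_0$ along $u_1\in U$ is $\frac{\partial G(z;u_0)}{\partial u}(u_1):=\lim_{\zeta\to0}\frac{G(z;u_0+\zeta u_1)-G(z;u_0)}{\zeta}$. It defines a linear functional $\frac{\partial G(z;u_0)}{\partial u}$ on $U$, and $\frac{\partial G(z;u_0)}{\partial u}[S]$ denotes the image of $S$ under this functional. For $u\in S$ and $z\in\Sigma_G(u)$, $z$ is called a strongly $u$-local interior point of $\Sigma_G[S]$ if $z$ is an interior point of the set $\Sigma_G[S\cap W]$ for every open (in the norm topology of $U$) neighborhood $W$ of $u$. *)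

theory Defs
  imports "HOL-Analysis.Analysis"
begin

text \<open>Complex normed spaces extend the real ones by a compatible complex scalar multiplication,
  so the topology and \<^const>\<open>convex\<close> are those of the underlying real normed space.\<close>

class complex_normed_vector = real_normed_vector +
  fixes scaleC :: "complex \<Rightarrow> 'a \<Rightarrow> 'a" (infixr "*\<^sub>C" 75)
  assumes scaleC_add_right: "a *\<^sub>C (x + y) = a *\<^sub>C x + a *\<^sub>C y"
    and scaleC_add_left: "(a + b) *\<^sub>C x = a *\<^sub>C x + b *\<^sub>C x"
    and scaleC_scaleC: "a *\<^sub>C (b *\<^sub>C x) = (a * b) *\<^sub>C x"
    and scaleC_of_real: "complex_of_real r *\<^sub>C x = r *\<^sub>R x"
    and norm_scaleC: "norm (a *\<^sub>C x) = cmod a * norm x"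

class complex_banach = complex_normed_vector + banach

instantiation complex :: complex_banach
begin

definition scaleC_complex :: "complex \<Rightarrow> complex \<Rightarrow> complex" where
  "scaleC_complex a x = a * x"

instance
  by standard (simp_all add: scaleC_complex_def algebra_simps norm_mult scaleR_conv_of_real)

end

instantiation prod :: (complex_normed_vector, complex_normed_vector) complex_normed_vector
begin

definition scaleC_prod :: "complex \<Rightarrow> 'a \<times> 'b \<Rightarrow> 'a \<times> 'b" where
  "scaleC_prod a p = (a *\<^sub>C fst p, a *\<^sub>C snd p)"

instance
proof
  fix a :: complex and x :: "'a \<times> 'b"
  have "norm (a *\<^sub>C x) = sqrt ((cmod a)\<^sup>2 * ((norm (fst x))\<^sup>2 + (norm (snd x))\<^sup>2))"
    by (simp add: scaleC_prod_def norm_prod_def norm_scaleC power_mult_distrib distrib_left)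
  then show "norm (a *\<^sub>C x) = cmod a * norm x"
    by (simp add: norm_prod_def real_sqrt_mult)
qed (simp_all add: scaleC_prod_def scaleC_add_right scaleC_add_left scaleC_scaleC
      scaleC_of_real prod_eq_iff)

end

instance prod :: (complex_banach, complex_banach) complex_banach ..

text \<open>A map between complex Banach spaces is analytic (on the whole space) if it has a complex
  Frechet derivative at every point. The predicate \<^const>\<open>has_derivative\<close> only provides a bounded
  real-linear derivative, hence the additional complex homogeneity.\<close>

definition analytic_map :: "('a::complex_banach \<Rightarrow> 'b::complex_banach) \<Rightarrow> bool" where
  "analytic_map f \<longleftrightarrow>
    (\<forall>x. \<exists>D. (f has_derivative D) (at x) \<and> (\<forall>c h. D (c *\<^sub>C h) = c *\<^sub>C D h))"

definition zeros_at :: "(complex \<Rightarrow> 'u \<Rightarrow> complex) \<Rightarrow> 'u \<Rightarrow> complex set" where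
  "zeros_at G u = {z. G z u = 0}"

definition zeros_over :: "(complex \<Rightarrow> 'u \<Rightarrow> complex) \<Rightarrow> 'u set \<Rightarrow> complex set" where
  "zeros_over G S = (\<Union>u\<in>S. zeros_at G u)"

text \<open>The increment \<open>\<zeta>\<close> tends to 0 through complex values.\<close>

definition dir_deriv ::
    "(complex \<Rightarrow> 'u::complex_banach \<Rightarrow> complex) \<Rightarrow> complex \<Rightarrow> 'u \<Rightarrow> 'u \<Rightarrow> complex" where
  "dir_deriv G z u\<^sub>0 u\<^sub>1 = Lim (at 0) (\<lambda>\<zeta>::complex. (G z (u\<^sub>0 + \<zeta> *\<^sub>C u\<^sub>1) - G z u\<^sub>0) / \<zeta>)"

definition strongly_local_interior_point ::
    "(complex \<Rightarrow> 'u::complex_banach \<Rightarrow> complex) \<Rightarrow> 'u set \<Rightarrow> 'u \<Rightarrow> complex \<Rightarrow> bool" where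
  "strongly_local_interior_point G S u z \<longleftrightarrow>
    u \<in> S \<and> z \<in> zeros_at G u \<and>
    (\<forall>W. open W \<and> u \<in> W \<longrightarrow> z \<in> interior (zeros_over G (S \<inter> W)))"

end

theory Submission
  imports Defs
begin

text \<open>Four points of \<open>S\<close> on which the derivative \<open>L\<close> takes the values \<open>L u\<^sub>0 \<plusminus> e\<close> and
  \<open>L u\<^sub>0 \<plusminus> \<i> e\<close> give, by convexity, a continuous section \<open>\<phi>\<close> of \<open>L\<close> near \<open>L u\<^sub>0\<close> with values in
  \<open>S\<close> that is Lipschitz at the base point. For \<open>z\<close> close to \<open>z\<^sub>0\<close>, the map
  \<open>w \<mapsto> w - G z (\<phi> w)\<close> then sends a small closed disc into itself, and a Brouwer fixed point \<open>w\<close>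
  is a parameter \<open>\<phi> w \<in> S\<close> close to \<open>u\<^sub>0\<close> with \<open>G z (\<phi> w) = 0\<close>.\<close>

text \<open>The real and imaginary parts of \<open>w\<close> are split into positive and negative
  parts, which serve as nonnegative weights on four points of \<open>S\<close>. The weight left over
  falls on \<open>x\<close>, so that \<open>\<phi> w\<close> is a convex combination as long as
  \<open>w\<close> is small.\<close>

lemma convex_linear_section:
  fixes L :: "'a::real_normed_vector \<Rightarrow> complex"
  assumes "linear L" "convex S" "x \<in> S" "L x \<in> interior (L ` S)"
  obtains \<phi> C e where "0 < C" "0 < e" "continuous_on UNIV \<phi>"
    and "\<And>w. norm (\<phi> w - x) \<le> C * norm w"
    and "\<And>w. L (\<phi> w) = L x + w"
    and "\<And>w. norm w \<le> e \<Longrightarrow> \<phi> w \<in> S"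
proof -
  interpret L: linear L by fact
  obtain r where r: "r > 0" "cball (L x) r \<subseteq> L ` S"
    using assms(4) by (auto simp: mem_interior_cball)
  have "\<exists>v\<in>S. L v = L x + c" if "norm c \<le> r" for c
  proof -
    have "L x + c \<in> cball (L x) r" using that by (simp add: dist_norm)
    then show ?thesis using r(2) by force
  qed
  from this[of "of_real r"] this[of "- of_real r"] this[of "\<i> * of_real r"]
    this[of "- (\<i> * of_real r)"] r(1)
  obtain a b c d where S: "a \<in> S" "b \<in> S" "c \<in> S" "d \<in> S"
    and eqs: "L a = L x + of_real r" "L b = L x - of_real r"
      "L c = L x + \<i> * of_real r" "L d = L x - \<i> * of_real r"
    by (auto simp: norm_mult)
  define A where "A w = max (Re w) 0 / r" for w
  define B where "B w = max (- Re w) 0 / r" for w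
  define P where "P w = max (Im w) 0 / r" for w
  define Q where "Q w = max (- Im w) 0 / r" for w
  \<comment> \<open>Written as a displacement from \<open>x\<close>, the formula makes sense and is
    continuous for every \<open>w\<close>; only membership in \<open>S\<close> requires
    \<open>w\<close> to be small.\<close>
  define \<phi> where "\<phi> w = x + (A w *\<^sub>R (a - x) + B w *\<^sub>R (b - x) + P w *\<^sub>R (c - x) + Q w *\<^sub>R (d - x))" for w
  have nonneg: "A w \<ge> 0" "B w \<ge> 0" "P w \<ge> 0" "Q w \<ge> 0" for w
    using r(1) by (auto simp: A_def B_def P_def Q_def)
  have le: "A w \<le> norm w / r" "B w \<le> norm w / r" "P w \<le> norm w / r" "Q w \<le> norm w / r" for w
    using r(1) abs_Re_le_cmod[of w] abs_Im_le_cmod[of w]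
    by (auto simp: A_def B_def P_def Q_def intro!: divide_right_mono)
  define K where "K = norm (a - x) + norm (b - x) + norm (c - x) + norm (d - x)"
  show thesis
  proof
    \<comment> \<open>The summand 1 gives positivity without an argument that \<open>K\<close> is
      nonzero.\<close>
    show "0 < K / r + 1" using r(1) by (simp add: K_def add_nonneg_pos)
    \<comment> \<open>With this bound each of the four weights is at most 1/4, so the weight
      \<open>1 - (A w + B w + P w + Q w)\<close> of \<open>x\<close> is nonnegative.\<close>
    show "0 < r / 4" using r(1) by simp
    show "continuous_on UNIV \<phi>"
      unfolding \<phi>_def A_def B_def P_def Q_def using r(1) by (intro continuous_intros) auto
  next
    fix w
    have "norm (\<phi> w - x) \<le> A w * norm (a - x) + B w * norm (b - x) + P w * norm (c - x) + Q w * norm (d - x)"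
      unfolding \<phi>_def using nonneg[of w]
      by (auto intro!: norm_triangle_le add_mono)
    also have "\<dots> \<le> norm w / r * norm (a - x) + norm w / r * norm (b - x)
        + norm w / r * norm (c - x) + norm w / r * norm (d - x)"
      by (intro add_mono mult_right_mono le) auto
    also have "\<dots> = K / r * norm w" by (simp add: K_def algebra_simps add_divide_distrib)
    also have "\<dots> \<le> (K / r + 1) * norm w" by (simp add: distrib_right)
    finally show "norm (\<phi> w - x) \<le> (K / r + 1) * norm w" .
  next
    fix w
    have "L (\<phi> w) = L x + (of_real (A w - B w) * of_real r + of_real (P w - Q w) * (\<i> * of_real r))"
      by (simp add: \<phi>_def L.add L.scaleR L.diff eqs scaleR_conv_of_real algebra_simps)
    also have "A w - B w = Re w / r" by (simp add: A_def B_def max_def)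
    also have "P w - Q w = Im w / r" by (simp add: P_def Q_def max_def)
    finally show "L (\<phi> w) = L x + w" using r(1) by (simp add: complex_eq_iff)
  next
    fix w :: complex
    assume w: "norm w \<le> r / 4"
    then have "norm w / r \<le> 1 / 4" using r(1) by (simp add: field_simps)
    with le[of w] have le1: "A w + B w + P w + Q w \<le> 1" by linarith
    let ?f = "(!) [a, b, c, d, x]" and ?g = "(!) [A w, B w, P w, Q w, 1 - (A w + B w + P w + Q w)]"
    have "(\<Sum>i<5. ?g i *\<^sub>R ?f i) \<in> S"
    proof (rule convex_sum)
      show "sum ?g {..<5} = 1" by (simp add: eval_nat_numeral)
      show "0 \<le> ?g i" if "i \<in> {..<5}" for i
        using that nonneg[of w] le1 by (auto simp: eval_nat_numeral less_Suc_eq)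
      show "?f i \<in> S" if "i \<in> {..<5}" for i
        using that S assms(3) by (auto simp: eval_nat_numeral less_Suc_eq)
    qed (use assms(2) in auto)
    also have "(\<Sum>i<5. ?g i *\<^sub>R ?f i) = \<phi> w"
      by (simp add: eval_nat_numeral \<phi>_def algebra_simps)
    finally show "\<phi> w \<in> S" .
  qed
qed

text \<open>Along the section the linear part of \<open>f\<close> in the second variable is
  \<open>w\<close> itself. It cancels in \<open>w - f (z, \<phi> w)\<close>, leaving only the
  remainder of differentiation and the contribution of \<open>z - z\<^sub>0\<close>. Brouwer then
  asks for continuity and this size estimate, not for a contraction.\<close>

lemma zero_along_section:
  fixes f :: "'a::real_normed_vector \<times> 'b::real_normed_vector \<Rightarrow> 'c::euclidean_space"
  assumes cont: "continuous_on UNIV f" and der: "(f has_derivative D) (at (z\<^sub>0, u\<^sub>0))"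
    and zero: "f (z\<^sub>0, u\<^sub>0) = 0"
    and "0 < C" "continuous_on UNIV \<phi>"
    and lip: "\<And>w. norm (\<phi> w - u\<^sub>0) \<le> C * norm w"
    and sec: "\<And>w. D (0, \<phi> w - u\<^sub>0) = w"
    and "0 < e"
  obtains \<delta> where "0 < \<delta>" "\<And>z. dist z z\<^sub>0 < \<delta> \<Longrightarrow> \<exists>w. norm w \<le> e \<and> f (z, \<phi> w) = 0"
proof -
  interpret D: bounded_linear D using der by (rule has_derivative_bounded_linear)
  obtain K where K: "K > 0" "\<And>x. norm (D x) \<le> norm x * K"
    using D.pos_bounded by blast
  \<comment> \<open>This makes \<open>\<epsilon> * (C * \<rho>)\<close> equal to
    \<open>\<rho> / 2\<close>: the part of the remainder due to \<open>w\<close> uses half of the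
    radius.\<close>
  define \<epsilon> where "\<epsilon> = 1 / (2 * C)"
  have "\<epsilon> > 0" using \<open>C > 0\<close> by (simp add: \<epsilon>_def)
  then obtain d where d: "d > 0"
    "\<And>y. norm (y - (z\<^sub>0, u\<^sub>0)) < d \<Longrightarrow>
      norm (f y - f (z\<^sub>0, u\<^sub>0) - D (y - (z\<^sub>0, u\<^sub>0))) \<le> \<epsilon> * norm (y - (z\<^sub>0, u\<^sub>0))"
    using der unfolding has_derivative_at_alt by blast
  \<comment> \<open>The displacement of \<open>\<phi> w\<close> is then at most
    \<open>d / 4\<close>; together with \<open>d / 2\<close> for \<open>z\<close> the point stays
    within distance \<open>d\<close>, where the remainder bound applies.\<close>
  define \<rho> where "\<rho> = min e (d / (4 * C))"
  have \<rho>: "\<rho> > 0" "\<rho> \<le> e" "C * \<rho> \<le> d / 4"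
    using \<open>C > 0\<close> \<open>e > 0\<close> d(1) by (auto simp: \<rho>_def min_def field_simps)
  \<comment> \<open>The second term reserves the other half of the radius for
    \<open>z - z\<^sub>0\<close>: \<open>K\<close> accounts for its linear part,
    \<open>\<epsilon>\<close> for its share of the remainder.\<close>
  define \<delta> where "\<delta> = min (d / 2) (\<rho> / (2 * (K + \<epsilon>)))"
  have "\<delta> > 0" using \<rho> d(1) K \<open>\<epsilon> > 0\<close> by (simp add: \<delta>_def)
  moreover have "\<exists>w. norm w \<le> e \<and> f (z, \<phi> w) = 0" if z: "dist z z\<^sub>0 < \<delta>" for z
  proof -
    define F where "F w = w - f (z, \<phi> w)" for w
    have "F w \<in> cball 0 \<rho>" if w: "w \<in> cball 0 \<rho>" for w
    proof -
      let ?y = "(z, \<phi> w)" and ?x = "(z\<^sub>0, u\<^sub>0)"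
      have nw: "norm w \<le> \<rho>" using w by simp
      have "norm (\<phi> w - u\<^sub>0) \<le> C * \<rho>"
        using lip[of w] nw \<open>C > 0\<close> by (meson mult_left_mono order_trans less_imp_le)
      then have ny: "norm (?y - ?x) \<le> norm (z - z\<^sub>0) + C * \<rho>"
        using norm_Pair_le[of "z - z\<^sub>0" "\<phi> w - u\<^sub>0"] by simp
      have nz: "norm (z - z\<^sub>0) \<le> d / 2" "norm (z - z\<^sub>0) * (K + \<epsilon>) \<le> \<rho> / 2"
        using z K(1) \<open>\<epsilon> > 0\<close> by (auto simp: \<delta>_def dist_norm field_simps)
      have "norm (?y - ?x) < d" using ny nz(1) \<rho>(3) d(1) by linarith
      from d(2)[OF this] have "norm (f ?y - D (?y - ?x)) \<le> \<epsilon> * norm (?y - ?x)"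
        using zero by simp
      also have "\<dots> \<le> \<epsilon> * (norm (z - z\<^sub>0) + C * \<rho>)"
        using ny \<open>\<epsilon> > 0\<close> by (intro mult_left_mono) auto
      also have "\<dots> = \<epsilon> * norm (z - z\<^sub>0) + \<rho> / 2"
        using \<open>C > 0\<close> by (simp add: \<epsilon>_def field_simps)
      finally have 1: "norm (f ?y - D (?y - ?x)) \<le> \<epsilon> * norm (z - z\<^sub>0) + \<rho> / 2" .
      have "D (?y - ?x) = D (z - z\<^sub>0, 0) + w"
        using D.add[of "(z - z\<^sub>0, 0)" "(0, \<phi> w - u\<^sub>0)"] sec[of w] by simp
      then have "F w = - (f ?y - D (?y - ?x)) - D (z - z\<^sub>0, 0)"
        by (simp add: F_def)
      then have "norm (F w) \<le> norm (f ?y - D (?y - ?x)) + norm (D (z - z\<^sub>0, 0))"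
        by (metis norm_minus_cancel norm_triangle_ineq4)
      also have "norm (D (z - z\<^sub>0, 0)) \<le> norm (z - z\<^sub>0) * K"
        using K(2)[of "(z - z\<^sub>0, 0)"] by (simp add: norm_Pair)
      finally have "norm (F w) \<le> \<rho>" using 1 nz(2) by (simp add: algebra_simps)
      then show ?thesis by simp
    qed
    moreover have "continuous_on (cball 0 \<rho>) F"
      unfolding F_def using assms(5)
      by (intro continuous_intros continuous_on_compose2[OF cont]) (auto intro: continuous_on_subset)
    ultimately obtain w where "w \<in> cball 0 \<rho>" "F w = w"
      using brouwer[of "cball 0 \<rho>" F] \<rho>(1) by auto
    then show ?thesis using \<rho>(2) by (intro exI[of _ w]) (auto simp: F_def)
  qed
  ultimately show thesis using that by blast
qed

lemma bounded_linear_scaleC_left: "bounded_linear (\<lambda>c. c *\<^sub>C (x::'a::complex_normed_vector))"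
proof (rule bounded_linear_intro)
  show "(r *\<^sub>R c) *\<^sub>C x = r *\<^sub>R (c *\<^sub>C x)" for r c
    by (simp add: scaleR_conv_of_real flip: scaleC_scaleC scaleC_of_real)
qed (auto simp: scaleC_add_left norm_scaleC)

text \<open>The chain rule along the complex line through \<open>u\<close> in direction
  \<open>v\<close> yields a real derivative; homogeneity of \<open>D\<close> turns it into
  multiplication by \<open>D (0, v)\<close>, hence into a complex derivative. So the
  \<open>Lim\<close> in \<open>dir_deriv\<close> is a genuine limit.\<close>

lemma dir_deriv_eq:
  fixes G :: "complex \<Rightarrow> 'u::complex_banach \<Rightarrow> complex"
  assumes der: "((\<lambda>(z, u). G z u) has_derivative D) (at (z, u))"
    and hom: "\<And>c h. D (c *\<^sub>C h) = c *\<^sub>C D h"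
  shows "dir_deriv G z u v = D (0, v)"
proof -
  interpret scaleC: bounded_linear "\<lambda>c. c *\<^sub>C v" by (rule bounded_linear_scaleC_left)
  have "((\<lambda>c. (z, u + c *\<^sub>C v)) has_derivative (\<lambda>c. (0, c *\<^sub>C v))) (at 0)"
    by (auto intro!: derivative_eq_intros scaleC.has_derivative)
  moreover have "((\<lambda>(z, u). G z u) has_derivative D) (at (z, u + 0 *\<^sub>C v))"
    using der by (simp add: scaleC.zero)
  ultimately have "((\<lambda>c. G z (u + c *\<^sub>C v)) has_derivative (\<lambda>c. D (0, c *\<^sub>C v))) (at 0)"
    using has_derivative_compose by fastforce
  moreover have "D (0, c *\<^sub>C v) = D (0, v) * c" for c
  proof -
    have "(0, c *\<^sub>C v) = c *\<^sub>C (0 :: complex, v)" by (simp add: scaleC_prod_def scaleC_complex_def)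
    then show ?thesis by (metis hom scaleC_complex_def mult.commute)
  qed
  ultimately have "((\<lambda>c. G z (u + c *\<^sub>C v)) has_field_derivative D (0, v)) (at 0)"
    by (simp add: has_field_derivative_def)
  then have "((\<lambda>c. (G z (u + c *\<^sub>C v) - G z u) / c) \<longlongrightarrow> D (0, v)) (at 0)"
    by (simp add: DERIV_def scaleC.zero)
  then show ?thesis unfolding dir_deriv_def by (intro tendsto_Lim) auto
qed

theorem theorem4p1:
  fixes G :: "complex \<Rightarrow> 'u::complex_banach \<Rightarrow> complex"
    and S :: "'u set" and z\<^sub>0 :: complex and u\<^sub>0 :: 'u
  assumes "analytic_map (\<lambda>(z, u). G z u)"
    and "convex S"
    and "u\<^sub>0 \<in> S" and "G z\<^sub>0 u\<^sub>0 = 0"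
    and "dir_deriv G z\<^sub>0 u\<^sub>0 u\<^sub>0 \<in> interior (dir_deriv G z\<^sub>0 u\<^sub>0 ` S)"
  shows "strongly_local_interior_point G S u\<^sub>0 z\<^sub>0"
proof -
  let ?f = "\<lambda>(z, u). G z u"
  obtain D where D: "(?f has_derivative D) (at (z\<^sub>0, u\<^sub>0))" "\<And>c h. D (c *\<^sub>C h) = c *\<^sub>C D h"
    using assms(1) unfolding analytic_map_def by blast
  interpret D: bounded_linear D using D(1) by (rule has_derivative_bounded_linear)
  have cont: "continuous_on UNIV ?f"
    using assms(1) unfolding analytic_map_def
    by (blast intro: continuous_at_imp_continuous_on has_derivative_continuous)
  define L where "L u = D (0, u)" for u
  have dir: "dir_deriv G z\<^sub>0 u\<^sub>0 = L"
    using dir_deriv_eq[OF D] by (auto simp: L_def)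
  have "linear L"
    unfolding L_def
    by (rule linearI) (use D.add[of "(0, _)" "(0, _)"] D.scaleR[of _ "(0, _)"] in auto)
  \<comment> \<open>The section is fixed once, before any neighborhood \<open>W\<close>; only the
    radius allowed for \<open>w\<close> will depend on \<open>W\<close>.\<close>
  then obtain \<phi> C e where \<phi>: "0 < C" "0 < e" "continuous_on UNIV \<phi>"
    "\<And>w. norm (\<phi> w - u\<^sub>0) \<le> C * norm w" "\<And>w. L (\<phi> w) = L u\<^sub>0 + w" "\<And>w. norm w \<le> e \<Longrightarrow> \<phi> w \<in> S"
    using convex_linear_section[OF _ assms(2,3)] assms(5) unfolding dir by metis
  have sec: "D (0, \<phi> w - u\<^sub>0) = w" for w
    using \<phi>(5)[of w] linear_diff[OF \<open>linear L\<close>, of "\<phi> w" u\<^sub>0] by (simp add: L_def)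
  have "z\<^sub>0 \<in> interior (zeros_over G (S \<inter> W))" if W: "open W" "u\<^sub>0 \<in> W" for W
  proof -
    obtain r where r: "r > 0" "cball u\<^sub>0 r \<subseteq> W"
      using W open_contains_cball by blast
    \<comment> \<open>The bound \<open>e\<close> keeps \<open>\<phi> w\<close> in \<open>S\<close>,
      and \<open>r / C\<close> keeps it within \<open>r\<close> of \<open>u\<^sub>0\<close>, hence
      in \<open>W\<close>.\<close>
    have "0 < min e (r / C)" using r(1) \<phi>(1,2) by simp
    from zero_along_section[OF cont D(1) _ \<phi>(1,3,4) sec this] assms(4)
    obtain \<delta> where \<delta>: "0 < \<delta>"
      "\<And>z. dist z z\<^sub>0 < \<delta> \<Longrightarrow> \<exists>w. norm w \<le> min e (r / C) \<and> ?f (z, \<phi> w) = 0"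
      by auto
    have "ball z\<^sub>0 \<delta> \<subseteq> zeros_over G (S \<inter> W)"
    proof
      fix z assume "z \<in> ball z\<^sub>0 \<delta>"
      then obtain w where w: "norm w \<le> e" "norm w \<le> r / C" "G z (\<phi> w) = 0"
        using \<delta>(2)[of z] by (auto simp: dist_commute)
      have "norm (\<phi> w - u\<^sub>0) \<le> r"
        using \<phi>(1) \<phi>(4)[of w] w(2) by (simp add: field_simps)
      then have "\<phi> w \<in> W" using r(2) by (auto simp: dist_norm norm_minus_commute)
      then show "z \<in> zeros_over G (S \<inter> W)"
        using w \<phi>(6) by (auto simp: zeros_over_def zeros_at_def)
    qed
    then show ?thesis using \<delta>(1) mem_interior by blast
  qed
  then show ?thesis
    using assms(3,4) by (simp add: strongly_local_interior_point_def zeros_at_def)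
qed

end
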